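(* Let $m\geq 2$ be an integer. For every integer $n\geq 2$ coprime to $m$, the number of elements $x\in\{0,1,\dotsc,n-1\}$ such that $$f_{m,n}(f_{m,n}(f_{m,n}(x)))=x$$ is at most $o_m(n)$. That is: for every $m\geq 2$ and every $\epsilon>0$ there is an $N$ (depending only on $m$ and $\epsilon$) such that, for every $n\geq N$ coprime to $m$, the equality $f_{m,n}(f_{m,n}(f_{m,n}(x)))=x$ holds for at most $\epsilon n$ elements $x\in\{0,1,\dotsc,n-1\}$.
   Context: For coprime integers $m,n\geq 2$, the map $f_{m,n}:\{0,1,\dotsc,n-1\}\to\{0,1,\dotsc,n-1\}$ is defined by letting $f_{m,n}(x)$ be the unique element of $\{0,1,\dotsc,n-1\}$ congruent to $m^x$ modulo $n$. The notation $o_m(n)$ means a function $b_m(n)$, possibly depending on $m$, such that $\lim_{n\to\infty} b_m(n)/n=0$ for each fixed $m$. *)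

theory Defs
  imports Complex_Main "HOL-Number_Theory.Cong"
begin

text \<open>
  The map is used only for coprime \<open>m, n \<ge> 2\<close> and for \<open>x < n\<close>. On that range it is the
  self-map of \<open>{..<n}\<close> characterised in \<open>exp_map_unique\<close>.
\<close>

definition exp_map :: "nat \<Rightarrow> nat \<Rightarrow> nat \<Rightarrow> nat" where
  "exp_map m n x = m ^ x mod n"

lemma exp_map_unique:
  assumes "n \<ge> 2"
  shows "y = exp_map m n x \<longleftrightarrow> y \<in> {..<n} \<and> [y = m ^ x] (mod n)"
  using assms by (auto simp: exp_map_def cong_def)

end

(*
  Let S be the set of x with f (f (f x)) = x and suppose that S has positive density. Two
  applications of Poincare recurrence give bounded l, j \<ge> 1 such that for a positive proportion of
  the x the points x, x + l, z, z + l all lie in S, where z is given by f z = f x + j. Since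
  f (x + k) = m^k f x modulo n, following f twice from f z = f x + j shows that z is
  x^(m^j) up to one of boundedly many units. Likewise f (z + l) = m^l f x + m^l j = f (x + l) + m^l j
  shows that z + l is (x + l)^(m^(m^l j)) up to one of boundedly many units. Eliminating z, a positive
  proportion of all x satisfies one of boundedly many polynomial congruences modulo n of bounded
  degree, with leading coefficient a unit. This is impossible for large n: by recurrence again, one
  can pass to finite differences until the congruence says that n divides a bounded nonzero
  integer times a unit.
*)
theory Submission
  imports Defs
begin

section \<open>Recurrence\<close>

text \<open>Pigeonhole: apart from at most one point per block of length \<open>B\<close>, every
  point of \<open>A\<close> is followed by another within distance \<open>B\<close>, so one of the
  \<open>B\<close> return sets has at least the average size.\<close>

lemma exists_frequent_difference:
  fixes A :: "nat set"
  assumes A: "A \<subseteq> {..<n}" and B: "B > 0"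
  shows "\<exists>h\<in>{1..B}. real (card A) \<le> real n / real B + 1 + real B * real (card {x \<in> A. x + h \<in> A})"
proof (rule ccontr)
  assume neg: "\<not> ?thesis"
  define R where "R h = {x \<in> A. x + h \<in> A}" for h
  define M where "M = A - (\<Union>h\<in>{1..B}. R h)"
  have finA: "finite A" using A finite_subset by blast
  have finR: "finite (R h)" for h using finA by (simp add: R_def)
  \<comment> \<open>Each block of length \<open>B\<close> contains at most one point of \<open>M\<close>, namely the last point of \<open>A\<close> in it.\<close>
  have no_eq: False if "x \<in> M" "y \<in> M" "x div B = y div B" "x < y" for x y
  proof -
    have "y = x div B * B + y mod B" using that(3) by simp
    then have "y - x \<le> B"
      using div_mult_mod_eq[of x B] mod_less_divisor[OF B, of y] by linarith
    then have "x \<in> R (y - x)" "y - x \<in> {1..B}"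
      using that by (auto simp: R_def M_def)
    then show False using that(1) by (auto simp: M_def)
  qed
  have "inj_on (\<lambda>x. x div B) M"
    by (rule inj_onI) (metis no_eq linorder_neqE_nat)
  moreover have "(\<lambda>x. x div B) ` M \<subseteq> {..n div B}"
    using A by (auto simp: M_def intro!: div_le_mono)
  ultimately have "card M \<le> card {..n div B}"
    by (intro card_inj_on_le) auto
  then have "card M \<le> n div B + 1" by simp
  moreover have "real (n div B) \<le> real n / real B"
    by (rule of_nat_div_le_of_nat)
  ultimately have M: "real (card M) \<le> real n / real B + 1" by linarith
  have "A \<subseteq> M \<union> (\<Union>h\<in>{1..B}. R h)" by (auto simp: M_def)
  then have "card A \<le> card (M \<union> (\<Union>h\<in>{1..B}. R h))"
    using finA finR by (intro card_mono) (auto simp: M_def)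
  also have "\<dots> \<le> card M + card (\<Union>h\<in>{1..B}. R h)" by (rule card_Un_le)
  also have "card (\<Union>h\<in>{1..B}. R h) \<le> (\<Sum>h\<in>{1..B}. card (R h))"
    by (rule card_UN_le) simp
  finally have "real (card A) \<le> real (card M) + (\<Sum>h\<in>{1..B}. real (card (R h)))"
    by (simp flip: of_nat_sum of_nat_add)
  also have "(\<Sum>h\<in>{1..B}. real (card (R h)))
      < (\<Sum>h\<in>{1..B}. (real (card A) - real n / real B - 1) / real B)"
  proof (rule sum_strict_mono)
    fix h assume "h \<in> {1..B}"
    then have "\<not> real (card A) \<le> real n / real B + 1 + real B * real (card (R h))"
      using neg by (auto simp: R_def)
    then show "real (card (R h)) < (real (card A) - real n / real B - 1) / real B"
      using B by (simp add: pos_less_divide_eq mult.commute)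
  qed (use B in auto)
  also have "\<dots> = real (card A) - real n / real B - 1" using B by simp
  finally show False using M by linarith
qed

text \<open>The bound \<open>H\<close> and the density \<open>\<delta>'\<close> depend on
  \<open>\<delta>\<close> alone, not on \<open>n\<close> or \<open>A\<close>; this uniformity is
  what allows recurrence to be iterated.\<close>

lemma recurrence:
  fixes \<delta> :: real
  assumes "\<delta> > 0"
  obtains H \<delta>' where "\<delta>' > 0"
    "\<forall>\<^sub>F n in sequentially. \<forall>A\<subseteq>{..<n}. real (card A) \<ge> \<delta> * real n \<longrightarrow>
       (\<exists>h\<in>{1..H}. real (card {x \<in> A. x + h \<in> A}) \<ge> \<delta>' * real n)"
proof -
  \<comment> \<open>This \<open>B\<close> makes \<open>n / B\<close> at most half of
    \<open>\<delta> * n\<close>, and \<open>n \<ge> 4 / \<delta>\<close> makes the summand 1 at most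
    a quarter; the last quarter, divided by \<open>B\<close>, gives
    \<open>\<delta>'\<close>.\<close>
  obtain B :: nat where B: "real B > 2 / \<delta>" using reals_Archimedean2 by blast
  then have B0: "B > 0"
    using assms by (metis divide_pos_pos of_nat_0_less_iff order_less_trans zero_less_numeral)
  have nB: "real n / real B \<le> \<delta> / 2 * real n" for n
  proof -
    have "1 / real B \<le> \<delta> / 2" using B B0 assms by (simp add: field_simps)
    then show ?thesis using mult_right_mono[of "1 / real B" "\<delta> / 2" "real n"] by simp
  qed
  have "\<forall>\<^sub>F n in sequentially. real n \<ge> 4 / \<delta>"
    using filterlim_real_sequentially filterlim_at_top by blast
  then have "\<forall>\<^sub>F n in sequentially. \<forall>A\<subseteq>{..<n}. real (card A) \<ge> \<delta> * real n \<longrightarrow>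
       (\<exists>h\<in>{1..B}. real (card {x \<in> A. x + h \<in> A}) \<ge> \<delta> / (4 * real B) * real n)"
  proof eventually_elim
    case (elim n)
    show ?case
    proof (intro allI impI)
      fix A assume A: "A \<subseteq> {..<n}" and card: "real (card A) \<ge> \<delta> * real n"
      obtain h where h: "h \<in> {1..B}"
        and le: "real (card A) \<le> real n / real B + 1 + real B * real (card {x \<in> A. x + h \<in> A})"
        using exists_frequent_difference[OF A B0] by blast
      have "\<delta> * real n \<ge> 4" using elim assms by (simp add: field_simps)
      then have "\<delta> / 4 * real n \<le> real B * real (card {x \<in> A. x + h \<in> A})"
        using le card nB[of n] by linarith
      then have "\<delta> / (4 * real B) * real n \<le> real (card {x \<in> A. x + h \<in> A})"
        using B0 by (simp add: field_simps)
      then show "\<exists>h\<in>{1..B}. real (card {x \<in> A. x + h \<in> A}) \<ge> \<delta> / (4 * real B) * real n"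
        using h by blast
    qed
  qed
  moreover have "\<delta> / (4 * real B) > 0" using assms B0 by simp
  ultimately show ?thesis using that by blast
qed

section \<open>Roots of polynomial congruences\<close>

text \<open>\<open>polyfun d a g\<close>: \<open>g\<close> behaves under differencing like a polynomial of degree at most \<open>d\<close>
  whose coefficient of \<open>x ^ d\<close> is \<open>a\<close>, where \<open>a = 0\<close> is allowed.\<close>

primrec polyfun :: "nat \<Rightarrow> int \<Rightarrow> (int \<Rightarrow> int) \<Rightarrow> bool" where
  "polyfun 0 a g \<longleftrightarrow> (\<forall>x. g x = a)"
| "polyfun (Suc d) a g \<longleftrightarrow> (\<forall>h. polyfun d (a * int (Suc d) * h) (\<lambda>x. g (x + h) - g x))"

lemma polyfun_add:
  "polyfun d a g \<Longrightarrow> polyfun d b k \<Longrightarrow> polyfun d (a + b) (\<lambda>x. g x + k x)"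
proof (induction d arbitrary: a b g k)
  case (Suc d)
  have "polyfun d (a * int (Suc d) * h + b * int (Suc d) * h)
      (\<lambda>x. (g (x + h) - g x) + (k (x + h) - k x))" for h
    using Suc.prems by (intro Suc.IH) simp_all
  then show ?case by (simp add: algebra_simps)
qed simp

lemma polyfun_cmult: "polyfun d a g \<Longrightarrow> polyfun d (c * a) (\<lambda>x. c * g x)"
proof (induction d arbitrary: a g)
  case (Suc d)
  have "polyfun d (c * (a * int (Suc d) * h)) (\<lambda>x. c * (g (x + h) - g x))" for h
    using Suc.prems by (intro Suc.IH) simp
  then show ?case by (simp add: algebra_simps)
qed simp

lemma polyfun_shift: "polyfun d a g \<Longrightarrow> polyfun d a (\<lambda>x. g (x + s))"
proof (induction d arbitrary: a g)
  case (Suc d)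
  have "polyfun d (a * int (Suc d) * h) (\<lambda>x. g (x + s + h) - g (x + s))" for h
    using Suc.prems by (intro Suc.IH[where g = "\<lambda>x. g (x + h) - g x"]) simp
  then show ?case by (simp add: algebra_simps)
qed simp

lemma polyfun_Suc_0: "polyfun d a g \<Longrightarrow> polyfun (Suc d) 0 g"
proof (induction d arbitrary: a g)
  case (Suc d)
  have "polyfun (Suc d) 0 (\<lambda>x. g (x + h) - g x)" for h
    using Suc.prems by (intro Suc.IH[where a = "a * int (Suc d) * h"]) simp
  then show ?case by (subst polyfun.simps(2)) (simp del: polyfun.simps)
qed simp

text \<open>Discrete product rule: the difference of \<open>x * g x\<close> is \<open>x\<close>
  times the difference of \<open>g\<close>, plus \<open>h * g (x + h)\<close>. The leading
  coefficients of the two terms add up to the required one.\<close>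

lemma polyfun_mult_id: "polyfun d a g \<Longrightarrow> polyfun (Suc d) a (\<lambda>x. x * g x)"
proof (induction d arbitrary: a g)
  case 0
  then show ?case by (simp add: algebra_simps)
next
  case (Suc d)
  have "polyfun (Suc d) (a * int (Suc d) * h + h * a)
      (\<lambda>x. x * (g (x + h) - g x) + h * g (x + h))" for h
    using Suc.prems
    by (intro polyfun_add Suc.IH polyfun_cmult polyfun_shift) simp_all
  moreover have "(\<lambda>x. x * (g (x + h) - g x) + h * g (x + h)) = (\<lambda>x. (x + h) * g (x + h) - x * g x)"
    for h
    by (simp add: algebra_simps)
  moreover have "a * int (Suc d) * h + h * a = a * int (Suc (Suc d)) * h" for h
    by (simp add: algebra_simps)
  ultimately show ?case by (simp only: polyfun.simps(2)[of "Suc d"]) simp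
qed

lemma polyfun_power: "polyfun d 1 (\<lambda>x. x ^ d)"
proof (induction d)
  case (Suc d)
  then show ?case using polyfun_mult_id[OF Suc] by (simp only: power_Suc)
qed simp

text \<open>Allows terms of lower degree to be added without changing the leading
  coefficient.\<close>

lemma polyfun_lower: "polyfun d a g \<Longrightarrow> d < e \<Longrightarrow> polyfun e 0 g"
proof (induction e)
  case (Suc e)
  then show ?case by (cases "d = e") (auto intro: polyfun_Suc_0 simp del: polyfun.simps)
qed simp

text \<open>If the roots were dense, recurrence would give a bounded \<open>h\<close> for which
  \<open>g (x + h) - g x\<close> of lower degree also has dense roots. Its leading coefficient gains
  only the bounded factor \<open>Suc d * h\<close>. In degree 0, \<open>n\<close> would divide
  \<open>a * u\<close>, hence \<open>a\<close>, which fails for \<open>n > K\<close>. The unit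
  \<open>u\<close> is kept apart from \<open>a\<close> because it may vary with \<open>n\<close>
  without bound.\<close>

lemma few_roots:
  fixes \<delta> :: real
  assumes "\<delta> > 0"
  shows "\<forall>\<^sub>F n in sequentially. \<forall>a u g. 0 < a \<and> a \<le> K \<and> coprime u n \<and> polyfun d (int (a * u)) g \<longrightarrow>
           real (card {x \<in> {..<n}. int n dvd g (int x)}) < \<delta> * real n"
  using assms
proof (induction d arbitrary: K \<delta>)
  case 0
  show ?case
    using eventually_gt_at_top[of K]
  proof eventually_elim
    case (elim n)
    show ?case
    proof (intro allI impI)
      fix a u :: nat and g
      assume *: "0 < a \<and> a \<le> K \<and> coprime u n \<and> polyfun 0 (int (a * u)) g"
      have "\<not> n dvd a * u"
      proof
        assume "n dvd a * u"
        then have "n dvd a" using * by (metis coprime_commute coprime_dvd_mult_left_iff)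
        then show False using * elim by (auto dest: dvd_imp_le)
      qed
      then have "\<not> int n dvd g x" for x using * by (simp flip: of_nat_mult)
      then show "real (card {x \<in> {..<n}. int n dvd g (int x)}) < \<delta> * real n"
        using elim 0 by simp
    qed
  qed
next
  case (Suc d)
  obtain H \<delta>' where \<delta>': "\<delta>' > 0" and rec:
    "\<forall>\<^sub>F n in sequentially. \<forall>A\<subseteq>{..<n}. real (card A) \<ge> \<delta> * real n \<longrightarrow>
       (\<exists>h\<in>{1..H}. real (card {x \<in> A. x + h \<in> A}) \<ge> \<delta>' * real n)"
    using recurrence[OF Suc.prems] by blast
  show ?case
    using rec Suc.IH[OF \<delta>', of "K * Suc d * H"]
  proof eventually_elim
    case (elim n)
    show ?case
    proof (intro allI impI, rule ccontr)
      fix a u :: nat and g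
      assume *: "0 < a \<and> a \<le> K \<and> coprime u n \<and> polyfun (Suc d) (int (a * u)) g"
      define Z where "Z = {x \<in> {..<n}. int n dvd g (int x)}"
      assume "\<not> real (card {x \<in> {..<n}. int n dvd g (int x)}) < \<delta> * real n"
      then have "real (card Z) \<ge> \<delta> * real n" "Z \<subseteq> {..<n}" by (auto simp: Z_def)
      then obtain h where h: "h \<in> {1..H}" "real (card {x \<in> Z. x + h \<in> Z}) \<ge> \<delta>' * real n"
        using elim(1) by blast
      let ?g = "\<lambda>x. g (x + int h) - g x"
      have "polyfun d (int (a * u) * int (Suc d) * int h) ?g" using * by simp
      then have "polyfun d (int (a * Suc d * h * u)) ?g" by (simp add: algebra_simps)
      moreover have "a * Suc d * h \<le> K * Suc d * H" using * h(1) by (intro mult_le_mono) auto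
      moreover have "0 < a * Suc d * h" using * h(1) by simp
      ultimately have lt: "real (card {x \<in> {..<n}. int n dvd ?g (int x)}) < \<delta>' * real n"
        using elim(2) * by blast
      have "{x \<in> Z. x + h \<in> Z} \<subseteq> {x \<in> {..<n}. int n dvd ?g (int x)}"
        by (auto simp: Z_def)
      then have "card {x \<in> Z. x + h \<in> Z} \<le> card {x \<in> {..<n}. int n dvd ?g (int x)}"
        by (intro card_mono) auto
      then show False using lt h(2) by linarith
    qed
  qed
qed

section \<open>The congruence satisfied on a recurrent configuration\<close>

lemma exp_map_less: "n > 0 \<Longrightarrow> exp_map m n x < n"
  by (simp add: exp_map_def)

lemma exp_map_add: "exp_map m n (x + k) = m ^ k * exp_map m n x mod n"
  by (simp add: exp_map_def power_add mult.commute mod_mult_right_eq)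

text \<open>Reducing the exponent \<open>c * y\<close> modulo \<open>n\<close> removes
  \<open>t * n\<close> with \<open>t = c * y div n\<close>, and \<open>t < c\<close> as
  \<open>y < n\<close>. Hence only \<open>c\<close> different correction factors
  \<open>m ^ (t * n)\<close> can occur.\<close>

lemma exp_map_scaled:
  assumes "y < n" "c > 0"
  shows "\<exists>t<c. [m ^ (t * n) * exp_map m n (c * y mod n) = exp_map m n y ^ c] (mod n)"
proof (intro exI conjI)
  show "c * y div n < c" using assms by (simp add: less_mult_imp_div_less)
  have "m ^ (c * y div n * n) * m ^ (c * y mod n) = m ^ (y * c)"
    by (simp flip: power_add add: mult.commute)
  then show "[m ^ (c * y div n * n) * exp_map m n (c * y mod n) = exp_map m n y ^ c] (mod n)"
    by (simp add: exp_map_def cong_def power_mod mod_mult_right_eq power_mult)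
qed

definition cyc3 :: "nat \<Rightarrow> nat \<Rightarrow> nat set" where
  "cyc3 m n = {x \<in> {..<n}. exp_map m n (exp_map m n (exp_map m n x)) = x}"

lemma inj_on_exp_map_cyc3: "inj_on (exp_map m n) (cyc3 m n)"
  by (rule inj_onI) (metis (mono_tags, lifting) cyc3_def mem_Collect_eq)

text \<open>The result of eliminating \<open>z\<close> from \<open>m ^ (t * n) * z = x ^ m ^ j\<close> and
  \<open>m ^ (t' * n) * (z + l) = (x + l) ^ m ^ (m ^ l * j)\<close> modulo \<open>n\<close>.\<close>

definition eliminant :: "nat \<Rightarrow> nat \<Rightarrow> nat \<Rightarrow> nat \<Rightarrow> nat \<Rightarrow> nat \<Rightarrow> int \<Rightarrow> int" where
  "eliminant m n l j t t' x =
     int (m ^ (t * n)) * (x + int l) ^ m ^ (m ^ l * j)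
     - int (m ^ (t' * n)) * (x ^ m ^ j + int l * int (m ^ (t * n)))"

text \<open>Since \<open>m ^ l > 1\<close> and \<open>j \<ge> 1\<close>, the exponent
  \<open>m ^ j\<close> is strictly below \<open>m ^ (m ^ l * j)\<close>, so the leading terms cannot
  cancel.\<close>

lemma polyfun_eliminant:
  assumes "m \<ge> 2" "l \<ge> 1" "j \<ge> 1"
  shows "polyfun (m ^ (m ^ l * j)) (int (m ^ (t * n))) (eliminant m n l j t t')"
proof -
  let ?E = "m ^ (m ^ l * j)"
  have "1 < m ^ l" using assms by (intro one_less_power) auto
  then have "j < m ^ l * j" using assms by simp
  then have less: "m ^ j < ?E" using assms by (intro power_strict_increasing) auto
  have 1: "polyfun ?E (int (m ^ (t * n)) * 1) (\<lambda>x. int (m ^ (t * n)) * (x + int l) ^ ?E)"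
    by (intro polyfun_cmult polyfun_shift[where g = "\<lambda>x. x ^ ?E"] polyfun_power)
  have 2: "polyfun ?E (- int (m ^ (t' * n)) * 0) (\<lambda>x. - int (m ^ (t' * n)) * x ^ m ^ j)"
    by (intro polyfun_cmult polyfun_lower[OF polyfun_power less])
  have 3: "polyfun ?E 0 (\<lambda>x. - int (m ^ (t' * n)) * (int l * int (m ^ (t * n))))"
    using assms by (intro polyfun_lower[of 0]) auto
  have "polyfun ?E (int (m ^ (t * n)) * 1 + (- int (m ^ (t' * n)) * 0 + 0))
      (\<lambda>x. int (m ^ (t * n)) * (x + int l) ^ ?E
        + (- int (m ^ (t' * n)) * x ^ m ^ j + - int (m ^ (t' * n)) * (int l * int (m ^ (t * n)))))"
    by (intro polyfun_add 1 2 3)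
  moreover have "(\<lambda>x. int (m ^ (t * n)) * (x + int l) ^ ?E
        + (- int (m ^ (t' * n)) * x ^ m ^ j + - int (m ^ (t' * n)) * (int l * int (m ^ (t * n)))))
      = eliminant m n l j t t'"
    by (rule ext) (simp add: eliminant_def algebra_simps)
  ultimately show ?thesis by simp
qed

text \<open>Applying \<open>exp_map m n\<close> to an argument requires the argument as a number,
  not just its residue; \<open>no_wrap\<close> turns the congruence for the image of
  \<open>z + l\<close> into an equality.\<close>

lemma recurrent_imp_eliminant_root:
  assumes m: "m \<ge> 2"
    and x: "x \<in> cyc3 m n" "x + l \<in> cyc3 m n"
    and z: "z \<in> cyc3 m n" "z + l \<in> cyc3 m n"
    and zx: "exp_map m n z = exp_map m n x + j"
    and no_wrap: "exp_map m n (x + l) + m ^ l * j < n"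
  shows "\<exists>t<m ^ j. \<exists>t'<m ^ (m ^ l * j). int n dvd eliminant m n l j t t' (int x)"
proof -
  let ?f = "exp_map m n" and ?E = "m ^ (m ^ l * j)"
  have n0: "n > 0" using no_wrap by simp
  have f3: "?f (?f (?f s)) = s" if "s \<in> cyc3 m n" for s using that by (simp add: cyc3_def)
  have "?f (?f z) = m ^ j * ?f (?f x) mod n"
    using exp_map_add zx by metis
  then have z_eq: "z = ?f (m ^ j * ?f (?f x) mod n)"
    using f3[OF z(1)] by simp
  have "\<exists>t<m ^ j. [m ^ (t * n) * z = ?f (?f (?f x)) ^ m ^ j] (mod n)"
    by (subst z_eq, rule exp_map_scaled) (use n0 m in \<open>auto intro: exp_map_less\<close>)
  then obtain t where t: "t < m ^ j" "[m ^ (t * n) * z = x ^ m ^ j] (mod n)"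
    using f3[OF x(1)] by metis
  have "?f (z + l) = (m ^ l * ?f x + m ^ l * j) mod n"
    using exp_map_add[of m n z l] by (simp add: zx algebra_simps)
  also have "\<dots> = (?f (x + l) + m ^ l * j) mod n"
    by (simp add: exp_map_add mod_add_left_eq)
  finally have "?f (z + l) = ?f (x + l) + m ^ l * j" using no_wrap by simp
  then have "?f (?f (z + l)) = ?E * ?f (?f (x + l)) mod n"
    using exp_map_add by metis
  then have zl_eq: "z + l = ?f (?E * ?f (?f (x + l)) mod n)"
    using f3[OF z(2)] by simp
  have "\<exists>t'<?E. [m ^ (t' * n) * (z + l) = ?f (?f (?f (x + l))) ^ ?E] (mod n)"
    by (subst zl_eq, rule exp_map_scaled) (use n0 m in \<open>auto intro: exp_map_less\<close>)
  then obtain t' where t': "t' < ?E" "[m ^ (t' * n) * (z + l) = (x + l) ^ ?E] (mod n)"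
    using f3[OF x(2)] by metis
  \<comment> \<open>The extra factor \<open>m ^ (t * n)\<close> makes \<open>m ^ (t * n) * z\<close>
    appear, so that \<open>z\<close> is eliminated without inverting \<open>m\<close> modulo
    \<open>n\<close>.\<close>
  have "[m ^ (t * n) * (x + l) ^ ?E = m ^ (t * n) * (m ^ (t' * n) * (z + l))] (mod n)"
    using t'(2) by (intro cong_mult cong_refl) (rule cong_sym)
  also have "m ^ (t * n) * (m ^ (t' * n) * (z + l)) = m ^ (t' * n) * (m ^ (t * n) * z + l * m ^ (t * n))"
    by (simp add: algebra_simps)
  also have "[\<dots> = m ^ (t' * n) * (x ^ m ^ j + l * m ^ (t * n))] (mod n)"
    using t(2) by (intro cong_mult cong_add cong_refl)
  finally have "[int (m ^ (t * n) * (x + l) ^ ?E)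
      = int (m ^ (t' * n) * (x ^ m ^ j + l * m ^ (t * n)))] (mod int n)"
    by (simp only: cong_int_iff)
  then have "int n dvd eliminant m n l j t t' (int x)"
    by (simp add: cong_iff_dvd_diff eliminant_def)
  then show ?thesis using t(1) t'(1) by blast
qed

section \<open>Density of recurrent configurations\<close>

lemma few_recurrent_points:
  fixes \<delta> :: real
  assumes m: "m \<ge> 2" and l: "l \<ge> 1" and j: "j \<ge> 1" and \<delta>: "\<delta> > 0"
  shows "\<forall>\<^sub>F n in sequentially. coprime m n \<longrightarrow>
    real (card {w \<in> exp_map m n ` {x \<in> cyc3 m n. x + l \<in> cyc3 m n}.
                w + j \<in> exp_map m n ` {x \<in> cyc3 m n. x + l \<in> cyc3 m n}}) < \<delta> * real n"
proof -
  \<comment> \<open>\<open>E\<close> is the degree of the eliminants and \<open>Q\<close> the number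
    of pairs \<open>(t, t')\<close>. Half of \<open>\<delta> * n\<close> is shared equally among the
    \<open>Q\<close> root sets, the other half absorbs the wrapped points.\<close>
  define E Q where "E = m ^ (m ^ l * j)" and "Q = m ^ j * E"
  have Q: "Q > 0" using m by (simp add: Q_def E_def)
  have "\<forall>\<^sub>F n in sequentially. real n > 2 * real (m ^ l * j) / \<delta>"
    using filterlim_real_sequentially filterlim_at_top_dense by blast
  moreover have "\<delta> / (2 * real Q) > 0" using \<delta> Q by simp
  \<comment> \<open>The bound is 1 because the leading coefficient \<open>m ^ (t * n)\<close> is
    itself a unit modulo \<open>n\<close>.\<close>
  note few_roots[OF this, of 1 E]
  ultimately show ?thesis
  proof eventually_elim
    case (elim n)
    show ?case
    proof
      assume cop: "coprime m n"
      let ?f = "exp_map m n"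
      define A where "A = {x \<in> cyc3 m n. x + l \<in> cyc3 m n}"
      define X where "X = {x \<in> A. ?f x + j \<in> ?f ` A}"
      define Wrap where "Wrap = {x \<in> A. n \<le> ?f (x + l) + m ^ l * j}"
      define Z where "Z p = {x \<in> {..<n}. int n dvd eliminant m n l j (fst p) (snd p) (int x)}"
        for p
      let ?P = "{..<m ^ j} \<times> {..<E}"
      have sub: "A \<subseteq> {..<n}" by (auto simp: A_def cyc3_def)
      then have fin: "finite A" using finite_subset by blast
      have "0 \<le> 2 * real (m ^ l * j) / \<delta>" using \<delta> by simp
      then have n0: "n > 0" using elim(1) by linarith

      \<comment> \<open>Wrapped points are sent injectively into the top \<open>m ^ l * j\<close>
        residues, so their number is bounded independently of \<open>n\<close>.\<close>
      have "inj_on (\<lambda>x. ?f (x + l)) Wrap"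
      proof (rule inj_onI)
        fix x y assume "x \<in> Wrap" "y \<in> Wrap" "?f (x + l) = ?f (y + l)"
        then have "x + l = y + l"
          using inj_on_exp_map_cyc3[of m n] by (auto simp: Wrap_def A_def dest: inj_onD)
        then show "x = y" by simp
      qed
      moreover have "(\<lambda>x. ?f (x + l)) ` Wrap \<subseteq> {n - m ^ l * j..<n}"
        using n0 by (auto simp: Wrap_def exp_map_less)
      ultimately have "card Wrap \<le> card {n - m ^ l * j..<n}"
        by (intro card_inj_on_le) auto
      then have Wrap: "card Wrap \<le> m ^ l * j" by simp

      have "real (card (Z p)) < \<delta> / (2 * real Q) * real n" if "p \<in> ?P" for p
      proof -
        have "coprime (m ^ (fst p * n)) n" using cop by simp
        then show ?thesis
          using elim(2)[rule_format, of 1 "m ^ (fst p * n)" "eliminant m n l j (fst p) (snd p)"]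
            polyfun_eliminant[OF m l j, of "fst p" n "snd p"]
          by (simp add: Z_def E_def)
      qed
      then have "(\<Sum>p\<in>?P. real (card (Z p))) \<le> (\<Sum>p\<in>?P. \<delta> / (2 * real Q) * real n)"
        by (intro sum_mono less_imp_le)
      also have "\<dots> = \<delta> / 2 * real n"
        using Q by (simp add: Q_def)
      finally have Z: "(\<Sum>p\<in>?P. real (card (Z p))) \<le> \<delta> / 2 * real n" .

      have "X \<subseteq> Wrap \<union> (\<Union>p\<in>?P. Z p)"
      proof
        fix x assume x: "x \<in> X"
        show "x \<in> Wrap \<union> (\<Union>p\<in>?P. Z p)"
        proof (cases "x \<in> Wrap")
          case False
          obtain z where z: "z \<in> A" "?f z = ?f x + j" using x by (auto simp: X_def)
          have "\<exists>t<m ^ j. \<exists>t'<m ^ (m ^ l * j). int n dvd eliminant m n l j t t' (int x)"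
            using x z False
            by (intro recurrent_imp_eliminant_root[OF m, where z = z]) (auto simp: X_def A_def Wrap_def)
          then show ?thesis using x sub by (force simp: X_def Z_def E_def)
        qed simp
      qed
      then have "card X \<le> card (Wrap \<union> (\<Union>p\<in>?P. Z p))"
        using fin by (intro card_mono) (auto simp: Wrap_def Z_def)
      also have "\<dots> \<le> card Wrap + card (\<Union>p\<in>?P. Z p)" by (rule card_Un_le)
      also have "card (\<Union>p\<in>?P. Z p) \<le> (\<Sum>p\<in>?P. card (Z p))" by (rule card_UN_le) simp
      finally have "real (card X) \<le> real (card Wrap) + (\<Sum>p\<in>?P. real (card (Z p)))"
        by (simp flip: of_nat_sum of_nat_add)
      also have "\<dots> < \<delta> / 2 * real n + \<delta> / 2 * real n"
      proof (rule add_less_le_mono[OF _ Z])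
        have "real (card Wrap) \<le> real (m ^ l * j)" using Wrap by (rule of_nat_mono)
        also have "\<dots> < \<delta> / 2 * real n"
          using elim(1) \<delta> by (simp add: pos_divide_less_eq mult.commute)
        finally show "real (card Wrap) < \<delta> / 2 * real n" .
      qed
      finally have X: "real (card X) < \<delta> * real n" by simp

      have "{w \<in> ?f ` A. w + j \<in> ?f ` A} = ?f ` X" by (auto simp: X_def)
      then have "card {w \<in> ?f ` A. w + j \<in> ?f ` A} \<le> card X"
        using fin by (simp add: X_def card_image_le)
      then have "real (card {w \<in> ?f ` A. w + j \<in> ?f ` A}) < \<delta> * real n"
        using X by linarith
      then show "real (card {w \<in> ?f ` {x \<in> cyc3 m n. x + l \<in> cyc3 m n}.
          w + j \<in> ?f ` {x \<in> cyc3 m n. x + l \<in> cyc3 m n}}) < \<delta> * real n"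
        unfolding A_def .
    qed
  qed
qed

theorem theorem1:
  fixes m :: nat and \<epsilon> :: real
  assumes "m \<ge> 2" and "\<epsilon> > 0"
  shows "\<exists>N::nat. \<forall>n::nat. n \<ge> N \<and> n \<ge> 2 \<and> coprime m n \<longrightarrow>
           real (card {x \<in> {..<n}. exp_map m n (exp_map m n (exp_map m n x)) = x}) \<le> \<epsilon> * real n"
proof -
  obtain L \<delta> where \<delta>: "\<delta> > 0" and rec_l:
    "\<forall>\<^sub>F n in sequentially. \<forall>A\<subseteq>{..<n}. real (card A) \<ge> \<epsilon> * real n \<longrightarrow>
       (\<exists>l\<in>{1..L}. real (card {x \<in> A. x + l \<in> A}) \<ge> \<delta> * real n)"
    using recurrence[OF assms(2)] by blast
  obtain J \<delta>' where \<delta>': "\<delta>' > 0" and rec_j: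
    "\<forall>\<^sub>F n in sequentially. \<forall>A\<subseteq>{..<n}. real (card A) \<ge> \<delta> * real n \<longrightarrow>
       (\<exists>j\<in>{1..J}. real (card {x \<in> A. x + j \<in> A}) \<ge> \<delta>' * real n)"
    using recurrence[OF \<delta>] by blast
  \<comment> \<open>Only finitely many pairs \<open>l\<close>, \<open>j\<close> arise, so one
    threshold for \<open>n\<close> serves them all.\<close>
  have "\<forall>\<^sub>F n in sequentially. \<forall>l\<in>{1..L}. \<forall>j\<in>{1..J}. coprime m n \<longrightarrow>
    real (card {w \<in> exp_map m n ` {x \<in> cyc3 m n. x + l \<in> cyc3 m n}.
                w + j \<in> exp_map m n ` {x \<in> cyc3 m n. x + l \<in> cyc3 m n}}) < \<delta>' * real n"
    using assms \<delta>' by (intro eventually_ball_finite ballI few_recurrent_points) auto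
  then have "\<forall>\<^sub>F n in sequentially. n \<ge> 2 \<and> coprime m n \<longrightarrow> real (card (cyc3 m n)) \<le> \<epsilon> * real n"
    using rec_l rec_j
  proof eventually_elim
    case (elim n)
    show ?case
    proof (rule impI, rule ccontr)
      assume n: "n \<ge> 2 \<and> coprime m n" and "\<not> real (card (cyc3 m n)) \<le> \<epsilon> * real n"
      then have "real (card (cyc3 m n)) \<ge> \<epsilon> * real n" "cyc3 m n \<subseteq> {..<n}"
        by (auto simp: cyc3_def)
      then obtain l where l: "l \<in> {1..L}"
        and card_l: "real (card {x \<in> cyc3 m n. x + l \<in> cyc3 m n}) \<ge> \<delta> * real n"
        using elim(2) by blast
      let ?A = "{x \<in> cyc3 m n. x + l \<in> cyc3 m n}"
      \<comment> \<open>The second recurrence is applied to the image, so that the shift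
        \<open>j\<close> separates values of \<open>exp_map m n\<close>; injectivity on
        \<open>cyc3 m n\<close> preserves the density.\<close>
      have "card (exp_map m n ` ?A) = card ?A"
        by (intro card_image inj_on_subset[OF inj_on_exp_map_cyc3]) auto
      then have "real (card (exp_map m n ` ?A)) \<ge> \<delta> * real n" using card_l by simp
      moreover have "exp_map m n ` ?A \<subseteq> {..<n}" using n by (auto intro: exp_map_less)
      ultimately obtain j where "j \<in> {1..J}"
        "real (card {w \<in> exp_map m n ` ?A. w + j \<in> exp_map m n ` ?A}) \<ge> \<delta>' * real n"
        using elim(3) by blast
      then show False using elim(1) l n by fastforce
    qed
  qed
  then show ?thesis by (auto simp: eventually_sequentially cyc3_def)
qed

end
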